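(* Let $\Sigma\ni0$ be a set of execution modes, $A_\sigma:\mathbb{R}^n\to\mathbb{R}^n$ for $\sigma\in\Sigma$, and consider the system $x_{k+1}=A_{\sigma_k}(x_k)+w_k$, $x_0\in\mathbb{R}^n$, $\sigma_k\in\Sigma$, $w_k\in\mathbb{R}^n$. Let $\alpha>0$, $\beta>0$ and $\rho_\sigma>0$ ($\sigma\in\Sigma$) be parameters of a linear convergence rate abstraction for weak execution of this system. For an execution sequence $(\sigma_k)_{k\in\mathbb{N}_0}$ in $\Sigma$ define $$\kappa_{a,b}:=\prod_{i=a}^{b-1}\rho_{\sigma_i},\qquad a\le b,$$ which for $w_k\equiv0$ is the ratio $\bar v_b/\bar v_a$ of abstraction states (when $\bar v_a\neq 0$). If the execution sequence $(\sigma_k)$ satisfies $$\kappa_{0,k}\le\tilde\alpha\tilde\rho^{\,k}\qquad\forall k\ge0$$ for some $\tilde\rho\in[0,1)$ and $\tilde\alpha\ge1$, then the system with this execution sequence and $w_k\equiv0$ is exponentially stable.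
   Context: $\mathbb{N}_0=\{0,1,2,\dots\}$; $|\cdot|$ is the Euclidean norm. Linear convergence rate abstraction for weak execution: parameters $\alpha,\beta,\rho_\sigma>0$ such that for every $x_0\in\mathbb{R}^n$, every sequence $(\sigma_k)$ in $\Sigma$ and every $(w_k)$ in $\mathbb{R}^n$, the solution of $x_{k+1}=A_{\sigma_k}(x_k)+w_k$ satisfies $|x_k|\le\bar v_k$ for all $k\ge0$, where $\bar v_{k+1}=\rho_{\sigma_k}\bar v_k+\beta|w_k|$ and $\bar v_0=\alpha|x_0|$. Exponential stability (for a given execution sequence and $w_k\equiv0$): there are constants $\alpha'\ge1$ and $\rho'\in(0,1)$ such that $|x_k|\le\alpha'(\rho')^k|x_0|$ for all $x_0\in\mathbb{R}^n$ and $k\in\mathbb{N}_0$. *)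

theory Defs
  imports "HOL-Analysis.Analysis"
begin

text \<open>The solution of \<open>x (k+1) = A (\<sigma> k) (x k) + w k\<close> with initial state \<open>x0\<close>.\<close>

primrec trajectory ::
  "('s \<Rightarrow> real ^ 'n \<Rightarrow> real ^ 'n) \<Rightarrow> (nat \<Rightarrow> 's) \<Rightarrow> (nat \<Rightarrow> real ^ 'n) \<Rightarrow> real ^ 'n \<Rightarrow> nat \<Rightarrow> real ^ 'n"
where
  "trajectory A \<sigma> w x0 0 = x0"
| "trajectory A \<sigma> w x0 (Suc k) = A (\<sigma> k) (trajectory A \<sigma> w x0 k) + w k"

primrec abstraction_state ::
  "real \<Rightarrow> real \<Rightarrow> ('s \<Rightarrow> real) \<Rightarrow> (nat \<Rightarrow> 's) \<Rightarrow> (nat \<Rightarrow> real ^ 'n) \<Rightarrow> real ^ 'n \<Rightarrow> nat \<Rightarrow> real"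
where
  "abstraction_state \<alpha> \<beta> \<rho> \<sigma> w x0 0 = \<alpha> * norm x0"
| "abstraction_state \<alpha> \<beta> \<rho> \<sigma> w x0 (Suc k) =
     \<rho> (\<sigma> k) * abstraction_state \<alpha> \<beta> \<rho> \<sigma> w x0 k + \<beta> * norm (w k)"

text \<open>Only the values of \<open>A\<close> and \<open>\<rho>\<close> on \<open>\<Sigma>\<close> matter; outside \<open>\<Sigma>\<close> they are arbitrary.\<close>

definition linear_convergence_rate_abstraction ::
  "'s set \<Rightarrow> ('s \<Rightarrow> real ^ 'n \<Rightarrow> real ^ 'n) \<Rightarrow> real \<Rightarrow> real \<Rightarrow> ('s \<Rightarrow> real) \<Rightarrow> bool"
where
  "linear_convergence_rate_abstraction \<Sigma> A \<alpha> \<beta> \<rho> \<longleftrightarrow>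
     \<alpha> > 0 \<and> \<beta> > 0 \<and> (\<forall>s\<in>\<Sigma>. \<rho> s > 0) \<and>
     (\<forall>x0 \<sigma> w. (\<forall>k. \<sigma> k \<in> \<Sigma>) \<longrightarrow>
        (\<forall>k. norm (trajectory A \<sigma> w x0 k) \<le> abstraction_state \<alpha> \<beta> \<rho> \<sigma> w x0 k))"

definition kappa :: "('s \<Rightarrow> real) \<Rightarrow> (nat \<Rightarrow> 's) \<Rightarrow> nat \<Rightarrow> nat \<Rightarrow> real" where
  "kappa \<rho> \<sigma> a b = (\<Prod>i\<in>{a..<b}. \<rho> (\<sigma> i))"

lemma kappa_eq_ratio:
  assumes "a \<le> b" and "abstraction_state \<alpha> \<beta> \<rho> \<sigma> (\<lambda>_. 0) x0 a \<noteq> 0"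
  shows "kappa \<rho> \<sigma> a b =
    abstraction_state \<alpha> \<beta> \<rho> \<sigma> (\<lambda>_. 0) x0 b / abstraction_state \<alpha> \<beta> \<rho> \<sigma> (\<lambda>_. 0) x0 a"
  using assms(1)
proof (induction b rule: dec_induct)
  case base
  then show ?case using assms(2) by (simp add: kappa_def)
next
  case (step k)
  then show ?case by (simp add: kappa_def atLeastLessThanSuc mult.commute)
qed

text \<open>Exponential stability under the fixed execution sequence \<open>\<sigma>\<close>, with \<open>w = 0\<close>; the
  constants are uniform in the initial state.\<close>

definition exponentially_stable ::
  "('s \<Rightarrow> real ^ 'n \<Rightarrow> real ^ 'n) \<Rightarrow> (nat \<Rightarrow> 's) \<Rightarrow> bool"
where
  "exponentially_stable A \<sigma> \<longleftrightarrow>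
     (\<exists>\<alpha>' \<rho>'. \<alpha>' \<ge> 1 \<and> 0 < \<rho>' \<and> \<rho>' < 1 \<and>
        (\<forall>x0 k. norm (trajectory A \<sigma> (\<lambda>_. 0) x0 k) \<le> \<alpha>' * \<rho>' ^ k * norm x0))"

end

theory Submission
  imports Defs
begin

text \<open>With zero disturbance the recursion is purely multiplicative: each step contributes one
  more factor \<open>\<rho> (\<sigma> k)\<close> to the initial value
  \<open>\<alpha> * norm x0\<close>.\<close>

lemma abstraction_state_eq_kappa:
  "abstraction_state \<alpha> \<beta> \<rho> \<sigma> (\<lambda>_. 0) x0 k = kappa \<rho> \<sigma> 0 k * (\<alpha> * norm x0)"
  by (induction k) (simp_all add: kappa_def mult_ac)

theorem theorem6p4:
  fixes \<Sigma> :: "'s::zero set"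
    and A :: "'s \<Rightarrow> real ^ 'n \<Rightarrow> real ^ 'n"
    and \<alpha> \<beta> :: real
    and \<rho> :: "'s \<Rightarrow> real"
    and \<sigma> :: "nat \<Rightarrow> 's"
    and \<alpha>t \<rho>t :: real
  assumes "0 \<in> \<Sigma>"
    and "linear_convergence_rate_abstraction \<Sigma> A \<alpha> \<beta> \<rho>"
    and "\<forall>k. \<sigma> k \<in> \<Sigma>"
    and "0 \<le> \<rho>t" and "\<rho>t < 1" and "\<alpha>t \<ge> 1"
    and "\<forall>k. kappa \<rho> \<sigma> 0 k \<le> \<alpha>t * \<rho>t ^ k"
  shows "exponentially_stable A \<sigma>"
proof -
  \<comment> \<open>Stability asks for constants \<open>\<rho>' > 0\<close> and \<open>\<alpha>' \<ge> 1\<close>, whereas \<open>\<rho>t = 0\<close> and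
    \<open>\<alpha> * \<alpha>t < 1\<close> are not excluded.\<close>
  define r where "r = max \<rho>t (1/2)"
  define a where "a = max 1 (\<alpha> * \<alpha>t)"
  have \<alpha>: "\<alpha> > 0"
    using assms(2) by (simp add: linear_convergence_rate_abstraction_def)
  have "norm (trajectory A \<sigma> (\<lambda>_. 0) x0 k) \<le> a * r ^ k * norm x0" for x0 k
  proof -
    have "norm (trajectory A \<sigma> (\<lambda>_. 0) x0 k) \<le> abstraction_state \<alpha> \<beta> \<rho> \<sigma> (\<lambda>_. 0) x0 k"
      using assms(2,3) by (simp add: linear_convergence_rate_abstraction_def)
    also have "\<dots> = kappa \<rho> \<sigma> 0 k * (\<alpha> * norm x0)"
      by (rule abstraction_state_eq_kappa)
    \<comment> \<open>The decay hypothesis is scaled by \<open>\<alpha> * norm x0\<close>,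
      nonnegative because \<alpha> > 0.\<close>
    also have "\<dots> \<le> (\<alpha>t * \<rho>t ^ k) * (\<alpha> * norm x0)"
      using assms(7) \<alpha> by (intro mult_right_mono) auto
    also have "\<dots> = (\<alpha> * \<alpha>t) * \<rho>t ^ k * norm x0"
      by (simp add: mult_ac)
    \<comment> \<open>Both constants only grow; \<open>0 \<le> \<rho>t\<close> makes the power
      monotone in its base.\<close>
    also have "\<dots> \<le> a * r ^ k * norm x0"
      using assms(4) by (intro mult_right_mono mult_mono power_mono) (auto simp: a_def r_def)
    finally show ?thesis .
  qed
  \<comment> \<open>The value 1/2 stands for any rate strictly between 0 and 1: it keeps
    \<open>r\<close> positive, and the maximum of two numbers below 1 is below 1.\<close>
  moreover have "a \<ge> 1" "0 < r" "r < 1"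
    using assms(5) by (auto simp: a_def r_def)
  ultimately show ?thesis
    unfolding exponentially_stable_def by blast
qed

end
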